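(* Let $f(z)$ be a meromorphic function with a discrete set of poles $\mathcal P$ and let $A\in\mathbb C^{m\times m}$ have spectrum $\mathcal S$ with $\mathcal S\cap\mathcal P=\emptyset$. Let $\Gamma$ be a (positively oriented) simple closed curve in the complex plane, not passing through any pole of $f$, which encloses $\mathcal S$ and whose enclosed poles of $f$ are exactly $T:=\{z_1,\dots,z_t\}\subseteq\mathcal P$, with orders $d_1,\dots,d_t$ respectively. Then \[ \frac{1}{2\pi i}\int_{\Gamma}(zI-A)^{-1}f(z)\,dz=f(A)+\sum_{j=1}^tR_j(z_jI-A), \] where $R_j$ is the rational function \[ R_j(z):=\sum_{l=1}^{d_j}(-1)^{l+1}\frac{f_j^{(d_j-l)}(z_j)}{(d_j-l)!}z^{-l} \] and $f_j(z)=(z-z_j)^{d_j}f(z)$, extended to the limit in $z_j$. In particular, if the poles in $T$ are simple, then \[ \frac{1}{2\pi i}\int_{\Gamma}(zI-A)^{-1}f(z)\,dz=f(A)+\sum_{j=1}^tf_j(z_j)\cdot(z_jI-A)^{-1}. \]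
   Context: $f(A)$ is the usual matrix function defined through the Jordan canonical form: if $V^{-1}AV=\mathrm{diag}(J_1,\dots,J_p)$ with $J_k$ an $m_k\times m_k$ Jordan block with eigenvalue $\lambda_k$, then $f(A)=V\,\mathrm{diag}(f(J_k))\,V^{-1}$, where $f(J_k)$ is the upper triangular Toeplitz matrix with first row $\left(f(\lambda_k),f'(\lambda_k),\dots,\frac{f^{(m_k-1)}(\lambda_k)}{(m_k-1)!}\right)$. For a rational function, $R_j(M)$ denotes evaluation at the matrix $M$, $z^{-l}$ becoming $M^{-l}$. *)

theory Defs
  imports
    "HOL-Complex_Analysis.Complex_Analysis"
    "Jordan_Normal_Form.Spectral_Radius"
    "Jordan_Normal_Form.Gauss_Jordan_Elimination"
begin

(* Matrices are those of Jordan_Normal_Form.Matrix; HOL-Analysis also has a constant "mat". *)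

(* Only meaningful for invertible M. *)
definition matrix_inverse :: "complex mat \<Rightarrow> complex mat" where
  "matrix_inverse M = the (mat_inverse M)"

definition matrix_sum :: "nat \<Rightarrow> ('i \<Rightarrow> complex mat) \<Rightarrow> 'i set \<Rightarrow> complex mat" where
  "matrix_sum m F I = finsum (module_mat TYPE(complex) m m) F I"

definition shifted :: "complex \<Rightarrow> complex mat \<Rightarrow> complex mat" where
  "shifted w A = w \<cdot>\<^sub>m 1\<^sub>m (dim_row A) - A"

definition matrix_contour_integral ::
  "nat \<Rightarrow> (real \<Rightarrow> complex) \<Rightarrow> (complex \<Rightarrow> complex mat) \<Rightarrow> complex mat" where
  "matrix_contour_integral m \<gamma> F =
     Matrix.mat m m (\<lambda>(i, k). contour_integral \<gamma> (\<lambda>w. F w $$ (i, k)))"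

definition fun_jordan_block :: "(complex \<Rightarrow> complex) \<Rightarrow> nat \<Rightarrow> complex \<Rightarrow> complex mat" where
  "fun_jordan_block f n a =
     Matrix.mat n n (\<lambda>(i, k). if i \<le> k then (deriv ^^ (k - i)) f a / fact (k - i) else 0)"

definition fun_jordan_matrix :: "(complex \<Rightarrow> complex) \<Rightarrow> (nat \<times> complex) list \<Rightarrow> complex mat" where
  "fun_jordan_matrix f n_as = diag_block_mat (map (\<lambda>(n, a). fun_jordan_block f n a) n_as)"

(* "similar_mat_wit A J V W" says A = V * J * W with W the two-sided inverse of V.
   The definite description expresses that the value does not depend on the chosen
   Jordan decomposition of A. *)
definition matrix_function :: "(complex \<Rightarrow> complex) \<Rightarrow> complex mat \<Rightarrow> complex mat" where
  "matrix_function f A =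
     (THE F. \<exists>n_as V W. 0 \<notin> fst ` set n_as
        \<and> similar_mat_wit A (jordan_matrix n_as) V W
        \<and> F = V * fun_jordan_matrix f n_as * W)"

(* The map w |-> (w - p)^d * f w, extended to its limit in p. *)
definition pole_cleared :: "(complex \<Rightarrow> complex) \<Rightarrow> complex \<Rightarrow> nat \<Rightarrow> complex \<Rightarrow> complex" where
  "pole_cleared f p d w =
     (if w = p then Lim (at p) (\<lambda>u. (u - p) ^ d * f u) else (w - p) ^ d * f w)"

(* Coefficient of z^(-l) in the rational function R attached to the pole p of order d. *)
definition R_coeff :: "(complex \<Rightarrow> complex) \<Rightarrow> complex \<Rightarrow> nat \<Rightarrow> nat \<Rightarrow> complex" where
  "R_coeff f p d l =
     (-1) ^ (l + 1) * ((deriv ^^ (d - l)) (pole_cleared f p d) p / fact (d - l))"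

(* R evaluated at an m x m matrix M. *)
definition R_matrix ::
  "nat \<Rightarrow> (complex \<Rightarrow> complex) \<Rightarrow> complex \<Rightarrow> nat \<Rightarrow> complex mat \<Rightarrow> complex mat" where
  "R_matrix m f p d M =
     matrix_sum m (\<lambda>l. R_coeff f p d l \<cdot>\<^sub>m (matrix_inverse M ^\<^sub>m l)) {1..d}"

(* Piecewise continuously differentiable, so that the contour integral makes sense. *)
definition simple_closed_curve :: "(real \<Rightarrow> complex) \<Rightarrow> bool" where
  "simple_closed_curve \<gamma> \<longleftrightarrow>
     valid_path \<gamma> \<and> simple_path \<gamma> \<and> pathfinish \<gamma> = pathstart \<gamma>"

definition positively_oriented :: "(real \<Rightarrow> complex) \<Rightarrow> bool" where
  "positively_oriented \<gamma> \<longleftrightarrow> (\<forall>w \<in> inside (path_image \<gamma>). winding_number \<gamma> w = 1)"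

end

theory Submission
  imports Defs
begin

text \<open>
  Fix a Jordan decomposition \<open>A = V J W\<close> with \<open>W\<close> inverse to \<open>V\<close>. The Toeplitz recipe for functions of a
  Jordan matrix, applied to \<open>x \<mapsto> 1 / (w - x)\<close>, produces the resolvent
  \<open>(w I - A)\<^sup>-\<^sup>1 = V (1 / (w - \<cdot>))(J) W\<close>. So every entry of the resolvent is a combination, with
  coefficients from \<open>V\<close> and \<open>W\<close>, of functions \<open>1 / (w - \<lambda>) ^ Suc s\<close> with \<open>\<lambda>\<close> an eigenvalue, and the
  theorem is the residue theorem applied to each entry of \<open>f(w) (w I - A)\<^sup>-\<^sup>1\<close>.

  Two kinds of singular points lie inside the curve. At an eigenvalue \<open>\<lambda>\<close> the function \<open>f\<close> is
  holomorphic, and the residue of \<open>f(w) / (w - \<lambda>) ^ Suc s\<close> there is the Taylor coefficient of order \<open>s\<close> of \<open>f\<close>,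
  which is precisely what the Toeplitz blocks of \<open>f(J)\<close> contain; added up, these residues
  give \<open>V f(J) W\<close> (\<open>sum_residues_resolvent\<close>). At a pole \<open>p\<close> of \<open>f\<close> the resolvent is holomorphic, and with
  \<open>N = (p I - A)\<^sup>-\<^sup>1\<close> the resolvent identity gives its Taylor expansion
  \<open>\<Sum>l<d. (p - w) ^ l N ^ Suc l\<close> up to a remainder that is divisible by \<open>(w - p) ^ d\<close>. Since the pole has order
  \<open>d\<close>, the remainder has no influence on the residue, and pairing the expansion with the principal
  part of \<open>f\<close> gives the rational function \<open>R\<close> at \<open>p I - A\<close> (\<open>residue_resolvent_at_pole\<close>).

  The left-hand side and the sum over the poles do not mention the Jordan decomposition. So the
  formula, proved for one arbitrary decomposition in \<open>contour_integral_resolvent\<close>, also shows that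
  \<open>V f(J) W\<close> is the same for all of them, which gives the definite description
  of \<open>f(A)\<close> its value.
\<close>

section \<open>Inverses, finite sums and entries of matrices\<close>

lemma matrix_inverse_eqI:
  assumes M: "M \<in> carrier_mat m m" and X: "X \<in> carrier_mat m m" and MX: "M * X = 1\<^sub>m m"
  shows "matrix_inverse M = X"
proof -
  have XM: "X * M = 1\<^sub>m m"
    using mat_mult_left_right_inverse[OF M X MX] .
  have unit: "M \<in> Units (ring_mat TYPE(complex) m undefined)"
    using M X MX XM unfolding Units_def by (auto simp: ring_mat_simps)
  with mat_inverse(1)[OF M, of undefined] obtain Y where Y: "mat_inverse M = Some Y"
    by (cases "mat_inverse M") auto
  from mat_inverse(2)[OF M Y] have YM: "Y * M = 1\<^sub>m m" and Yc: "Y \<in> carrier_mat m m"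
    by auto
  have "Y = Y * (M * X)" using Yc MX by simp
  also have "\<dots> = (Y * M) * X" using Yc M X by simp
  also have "\<dots> = X" using YM X by simp
  finally show ?thesis by (simp add: matrix_inverse_def Y)
qed

lemma matrix_sum_empty [simp]: "matrix_sum m F {} = 0\<^sub>m m m"
proof -
  interpret abelian_group "module_mat TYPE(complex) m m"
    by (rule abelian_group_mat)
  show ?thesis unfolding matrix_sum_def by (simp add: module_mat_simps)
qed

lemma matrix_sum_insert:
  assumes "finite I" "x \<notin> I" "\<And>j. j \<in> insert x I \<Longrightarrow> F j \<in> carrier_mat m m"
  shows "matrix_sum m F (insert x I) = F x + matrix_sum m F I"
proof -
  interpret abelian_group "module_mat TYPE(complex) m m"
    by (rule abelian_group_mat)
  show ?thesis unfolding matrix_sum_def using assms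
    by (subst finsum_insert) (auto simp: module_mat_simps)
qed

lemma matrix_sum_carrier:
  assumes "finite I" "\<And>j. j \<in> I \<Longrightarrow> F j \<in> carrier_mat m m"
  shows "matrix_sum m F I \<in> carrier_mat m m"
  using assms
proof (induction I rule: finite_induct)
  case (insert x I)
  then have "matrix_sum m F (insert x I) = F x + matrix_sum m F I"
    by (intro matrix_sum_insert) auto
  with insert show ?case by simp
qed simp

lemma matrix_sum_index:
  assumes "finite I" "\<And>j. j \<in> I \<Longrightarrow> F j \<in> carrier_mat m m" "i < m" "k < m"
  shows "matrix_sum m F I $$ (i, k) = (\<Sum>j\<in>I. F j $$ (i, k))"
  using assms
proof (induction I rule: finite_induct)
  case (insert x I)
  have "matrix_sum m F I \<in> carrier_mat m m"
    using insert by (intro matrix_sum_carrier) auto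
  moreover have "matrix_sum m F (insert x I) = F x + matrix_sum m F I"
    using insert by (intro matrix_sum_insert) auto
  ultimately show ?case using insert by simp
qed simp

lemma triple_product_index:
  fixes V :: "'a :: comm_ring_1 mat"
  assumes "V \<in> carrier_mat m m" "F \<in> carrier_mat m m" "W \<in> carrier_mat m m" "i < m" "k < m"
  shows "(V * F * W) $$ (i, k) =
    (\<Sum>(a, b)\<in>{..<m} \<times> {..<m}. V $$ (i, a) * W $$ (b, k) * F $$ (a, b))"
proof -
  have "(V * F * W) $$ (i, k) = (\<Sum>b<m. (V * F) $$ (i, b) * W $$ (b, k))"
    using assms by (simp add: scalar_prod_def atLeast0LessThan del: assoc_mult_mat)
  also have "\<dots> = (\<Sum>b<m. (\<Sum>a<m. V $$ (i, a) * F $$ (a, b)) * W $$ (b, k))"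
    using assms by (intro sum.cong) (auto simp: scalar_prod_def atLeast0LessThan)
  also have "\<dots> = (\<Sum>a<m. \<Sum>b<m. V $$ (i, a) * W $$ (b, k) * F $$ (a, b))"
    unfolding sum_distrib_right by (subst sum.swap) (intro sum.cong refl, simp add: ac_simps)
  finally show ?thesis by (simp add: sum.cartesian_product)
qed

lemma add_right_cancel_mat:
  fixes X Y S :: "'a :: group_add mat"
  assumes "X \<in> carrier_mat m m" "Y \<in> carrier_mat m m" "S \<in> carrier_mat m m" "X + S = Y + S"
  shows "X = Y"
proof (rule eq_matI)
  fix i k assume ik: "i < dim_row Y" "k < dim_col Y"
  have "(X + S) $$ (i, k) = (Y + S) $$ (i, k)" using assms(4) by simp
  with assms(1-3) ik show "X $$ (i, k) = Y $$ (i, k)" by simp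
qed (use assms in auto)

lemma shifted_carrier: "A \<in> carrier_mat m m \<Longrightarrow> shifted w A \<in> carrier_mat m m"
  by (auto simp: shifted_def)

text \<open>
  This is the resolvent identity: multiplying \<open>w I - A = (p I - A) + (w - p) I\<close> by the inverses \<open>N\<close>
  on the left and \<open>R\<close> on the right gives \<open>R = N - (w - p) N R\<close>. Multiplied by \<open>N ^ l\<close>, this trades one factor \<open>w - p\<close> for one power of
  \<open>N\<close>, so that iterating it develops \<open>R\<close> in powers of \<open>w - p\<close>.
\<close>

lemma resolvent_expansion_step:
  assumes A: "A \<in> carrier_mat m m" and N: "N \<in> carrier_mat m m" and R: "R \<in> carrier_mat m m"
    and NA: "N * shifted p A = 1\<^sub>m m" and AR: "shifted w A * R = 1\<^sub>m m"
    and ik: "i < m" "k < m"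
  shows "(N ^\<^sub>m l * R) $$ (i, k) =
    (N ^\<^sub>m Suc l) $$ (i, k) - (w - p) * (N ^\<^sub>m Suc l * R) $$ (i, k)"
proof -
  have SA: "shifted p A \<in> carrier_mat m m" "shifted w A \<in> carrier_mat m m"
    using A by (auto intro: shifted_carrier)
  have S: "shifted w A = shifted p A + (w - p) \<cdot>\<^sub>m 1\<^sub>m m"
    using A by (intro eq_matI) (auto simp: shifted_def algebra_simps)
  have "N = N * shifted w A * R"
    using N R SA AR by (simp add: assoc_mult_mat[of _ m m _ m _ m])
  also have "N * shifted w A = 1\<^sub>m m + (w - p) \<cdot>\<^sub>m N"
    using N SA NA mult_smult_distrib[OF N one_carrier_mat, of "w - p"]
    by (simp add: S mult_add_distrib_mat[of N m m _ m])
  also have "(1\<^sub>m m + (w - p) \<cdot>\<^sub>m N) * R = R + (w - p) \<cdot>\<^sub>m (N * R)"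
    using N R by (simp add: add_mult_distrib_mat[of _ m m _ R m] mult_smult_assoc_mat[OF N R])
  finally have N_eq: "N = R + (w - p) \<cdot>\<^sub>m (N * R)" .
  have Nl: "N ^\<^sub>m l \<in> carrier_mat m m" using N by simp
  have NR: "N * R \<in> carrier_mat m m" using N R by simp
  have "N ^\<^sub>m Suc l = N ^\<^sub>m l * (R + (w - p) \<cdot>\<^sub>m (N * R))"
    using N_eq by simp
  also have "\<dots> = N ^\<^sub>m l * R + (w - p) \<cdot>\<^sub>m (N ^\<^sub>m l * (N * R))"
    using Nl R NR by (simp add: mult_add_distrib_mat[of _ m m _ m] mult_smult_distrib[of _ m m _ m])
  also have "N ^\<^sub>m l * (N * R) = N ^\<^sub>m Suc l * R"
    using assoc_mult_mat[OF Nl N R] by simp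
  finally have "(N ^\<^sub>m Suc l) $$ (i, k) =
    (N ^\<^sub>m l * R + (w - p) \<cdot>\<^sub>m (N ^\<^sub>m Suc l * R)) $$ (i, k)" by (rule arg_cong)
  also have "\<dots> = (N ^\<^sub>m l * R) $$ (i, k) + (w - p) * (N ^\<^sub>m Suc l * R) $$ (i, k)"
    using carrier_matD[OF Nl] carrier_matD[OF N] carrier_matD[OF R] ik
    by (simp del: index_mult_mat(1) assoc_mult_mat pow_mat.simps)
  finally show ?thesis by simp
qed

lemma alternating_expansion:
  fixes x :: "'a :: comm_ring_1"
  assumes "\<And>l. b l = a l - x * b (Suc l)"
  shows "b 0 = (\<Sum>l<d. (- x) ^ l * a l) + (- x) ^ d * b d"
proof (induction d)
  case (Suc d)
  then show ?case by (simp add: assms[of d] algebra_simps)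
qed simp

section \<open>Functions of a Jordan matrix and its resolvent\<close>

lemma higher_deriv_reciprocal:
  fixes w :: complex
  assumes "a \<noteq> w"
  shows "(deriv ^^ s) (\<lambda>x. 1 / (w - x)) a = fact s / (w - a) ^ Suc s"
  using assms
proof (induction s arbitrary: a)
  case (Suc s)
  have "eventually (\<lambda>x. x \<in> - {w}) (nhds a)"
    using Suc.prems by (intro eventually_nhds_in_open) auto
  then have "eventually (\<lambda>x. (deriv ^^ s) (\<lambda>x. 1 / (w - x)) x = fact s / (w - x) ^ Suc s) (nhds a)"
    by eventually_elim (use Suc.IH in auto)
  then have "(deriv ^^ Suc s) (\<lambda>x. 1 / (w - x)) a = deriv (\<lambda>x. fact s / (w - x) ^ Suc s) a"
    by (simp add: deriv_cong_ev)
  also have "\<dots> = deriv (\<lambda>x. fact s * inverse (w - x) ^ Suc s) a"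
    by (simp add: field_simps)
  also have "\<dots> = fact s * (of_nat (Suc s) * (inverse (w - a) ^ 2 * inverse (w - a) ^ s))"
  proof -
    have "((\<lambda>x. inverse (w - x)) has_field_derivative inverse (w - a) ^ 2) (at a)"
      using Suc.prems by (auto intro!: derivative_eq_intros simp: power2_eq_square)
    from DERIV_cmult[OF DERIV_power_Suc[OF this]] show ?thesis
      by (intro DERIV_imp_deriv) (simp add: algebra_simps)
  qed
  also have "\<dots> = fact (Suc s) / (w - a) ^ Suc (Suc s)"
    by (simp add: field_simps power2_eq_square)
  finally show ?case .
qed simp

lemma fun_jordan_block_carrier [simp]: "fun_jordan_block f n a \<in> carrier_mat n n"
  by (simp add: fun_jordan_block_def)

lemma fun_jordan_matrix_carrier:
  "fun_jordan_matrix f n_as \<in> carrier_mat (sum_list (map fst n_as)) (sum_list (map fst n_as))"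
proof -
  have "dim_row (fun_jordan_block f n a) = n" "dim_col (fun_jordan_block f n a) = n" for n a
    by (simp_all add: fun_jordan_block_def)
  then show ?thesis
    by (intro carrier_matI)
       (simp_all add: fun_jordan_matrix_def dim_diag_block_mat o_def case_prod_unfold)
qed

lemma fun_jordan_matrix_Cons:
  "fun_jordan_matrix f ((n, a) # n_as) =
    four_block_mat (fun_jordan_block f n a) (0\<^sub>m n (sum_list (map fst n_as)))
      (0\<^sub>m (sum_list (map fst n_as)) n) (fun_jordan_matrix f n_as)"
proof -
  have "dim_row (fun_jordan_matrix f n_as) = sum_list (map fst n_as)"
    "dim_col (fun_jordan_matrix f n_as) = sum_list (map fst n_as)"
    using carrier_matD[OF fun_jordan_matrix_carrier] by auto
  moreover have "dim_row (fun_jordan_block f n a) = n" "dim_col (fun_jordan_block f n a) = n"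
    using carrier_matD[OF fun_jordan_block_carrier] by auto
  ultimately show ?thesis
    by (simp add: fun_jordan_matrix_def Let_def)
qed

text \<open>
  The alternative, the point \<open>a\<close> and the order \<open>s\<close> are chosen before \<open>f\<close>: this makes it possible to
  compare the entry for a given function with the same entry for \<open>x \<mapsto> 1 / (w - x)\<close>.
\<close>

lemma fun_jordan_matrix_index_cases:
  assumes "i < sum_list (map fst n_as)" "k < sum_list (map fst n_as)"
  shows "(\<forall>f. fun_jordan_matrix f n_as $$ (i, k) = 0) \<or>
    (\<exists>a\<in>snd ` set n_as. \<exists>s. \<forall>f. fun_jordan_matrix f n_as $$ (i, k) = (deriv ^^ s) f a / fact s)"
  using assms
proof (induction n_as arbitrary: i k)
  case (Cons na n_as)
  obtain n a where na: "na = (n, a)" by force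
  let ?N = "sum_list (map fst n_as)"
  have index: "fun_jordan_matrix f (na # n_as) $$ (i, k) =
    (if i < n then if k < n then fun_jordan_block f n a $$ (i, k) else 0
     else if k < n then 0 else fun_jordan_matrix f n_as $$ (i - n, k - n))" for f
    using Cons.prems carrier_matD[OF fun_jordan_matrix_carrier[of f n_as]]
      carrier_matD[OF fun_jordan_block_carrier[of f n a]]
    unfolding na fun_jordan_matrix_Cons by (subst index_mat_four_block) auto
  consider "i < n" "k < n" | "(i < n) \<noteq> (k < n)" | "\<not> i < n" "\<not> k < n" by blast
  then show ?case
  proof cases
    case 1
    then show ?thesis
      unfolding index by (cases "i \<le> k") (auto simp: na fun_jordan_block_def)
  next
    case 2
    then show ?thesis by (auto simp: index)
  next
    case 3
    with Cons.prems have "i - n < ?N" "k - n < ?N" by (auto simp: na)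
    from Cons.IH[OF this] 3 show ?thesis by (auto simp: index)
  qed
qed simp

lemma reciprocal_jordan_matrix_index_cases:
  assumes "i < sum_list (map fst n_as)" "k < sum_list (map fst n_as)"
  obtains "\<And>f. fun_jordan_matrix f n_as $$ (i, k) = 0"
  | a s where "a \<in> snd ` set n_as"
      "\<And>f. fun_jordan_matrix f n_as $$ (i, k) = (deriv ^^ s) f a / fact s"
      "\<And>w. w \<noteq> a \<Longrightarrow> fun_jordan_matrix (\<lambda>x. 1 / (w - x)) n_as $$ (i, k) = 1 / (w - a) ^ Suc s"
proof -
  consider "\<And>f. fun_jordan_matrix f n_as $$ (i, k) = 0"
    | a s where "a \<in> snd ` set n_as"
      "\<And>f. fun_jordan_matrix f n_as $$ (i, k) = (deriv ^^ s) f a / fact s"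
    using fun_jordan_matrix_index_cases[OF assms] by blast
  then show thesis
  proof cases
    case (2 a s)
    with that(2)[of a s] show thesis by (simp add: higher_deriv_reciprocal del: power_Suc)
  qed (rule that(1))
qed

lemma reciprocal_jordan_matrix_holomorphic:
  assumes "i < sum_list (map fst n_as)" "k < sum_list (map fst n_as)"
  shows "(\<lambda>w. fun_jordan_matrix (\<lambda>x. 1 / (w - x)) n_as $$ (i, k)) holomorphic_on - snd ` set n_as"
  using assms
proof (cases rule: reciprocal_jordan_matrix_index_cases)
  case (2 a s)
  have "(\<lambda>w. 1 / (w - a) ^ Suc s) holomorphic_on - snd ` set n_as"
    using 2(1) by (intro holomorphic_intros) auto
  then show ?thesis
    by (subst holomorphic_cong[OF refl 2(3)]) (use 2(1) in auto)
qed simp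

text \<open>
  The Toeplitz matrix of \<open>x \<mapsto> 1 / (w - x)\<close> has the entries \<open>1 / (w - a) ^ Suc (k - i)\<close> on and above
  the diagonal. Row \<open>i\<close> of \<open>w I - J\<close> is \<open>w - a\<close> on the diagonal and \<open>-1\<close> next to it, so above the
  diagonal \<open>w - a\<close> times one entry of this geometric progression cancels the entry below it.
\<close>

lemma jordan_block_resolvent:
  assumes "w \<noteq> a"
  shows "shifted w (jordan_block n a) * fun_jordan_block (\<lambda>x. 1 / (w - x)) n a = 1\<^sub>m n"
proof (rule eq_matI)
  fix i k assume "i < dim_row (1\<^sub>m n :: complex mat)" "k < dim_col (1\<^sub>m n :: complex mat)"
  then have ik: "i < n" "k < n" by auto
  define G where "G = (\<lambda>l. fun_jordan_block (\<lambda>x. 1 / (w - x)) n a $$ (l, k))"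
  have G: "G l = (if l \<le> k then 1 / (w - a) ^ Suc (k - l) else 0)" if "l < n" for l
    using that ik assms unfolding G_def fun_jordan_block_def
    by (simp add: higher_deriv_reciprocal del: power_Suc)
  have "(shifted w (jordan_block n a) * fun_jordan_block (\<lambda>x. 1 / (w - x)) n a) $$ (i, k) =
    (\<Sum>l<n. shifted w (jordan_block n a) $$ (i, l) * G l)"
    using ik unfolding G_def
    by (simp add: scalar_prod_def atLeast0LessThan shifted_def fun_jordan_block_def)
  also have "\<dots> = (\<Sum>l<n. (if l = i then (w - a) * G l else 0) - (if l = Suc i then G l else 0))"
    using ik by (intro sum.cong) (auto simp: shifted_def)
  also have "\<dots> = (w - a) * G i - (if Suc i < n then G (Suc i) else 0)"
    using ik by (simp add: sum_subtractf)
  also have "\<dots> = 1\<^sub>m n $$ (i, k)"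
  proof (cases "i < k")
    case True
    then have "k - i = Suc (k - Suc i)" by auto
    with True ik assms show ?thesis by (simp add: G)
  next
    case False
    with ik assms show ?thesis by (auto simp: G)
  qed
  finally show "(shifted w (jordan_block n a) * fun_jordan_block (\<lambda>x. 1 / (w - x)) n a) $$ (i, k)
    = 1\<^sub>m n $$ (i, k)" .
qed (auto simp: shifted_def fun_jordan_block_def)

lemma jordan_matrix_resolvent:
  assumes "w \<notin> snd ` set n_as"
  shows "shifted w (jordan_matrix n_as) * fun_jordan_matrix (\<lambda>x. 1 / (w - x)) n_as =
    1\<^sub>m (sum_list (map fst n_as))"
  using assms
proof (induction n_as)
  case Nil
  then show ?case by (intro eq_matI) (auto simp: shifted_def jordan_matrix_def fun_jordan_matrix_def)
next
  case (Cons na n_as)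
  obtain n a where na: "na = (n, a)" by force
  let ?N = "sum_list (map fst n_as)" and ?g = "\<lambda>x. 1 / (w - x)"
  have shifted: "shifted w (jordan_matrix (na # n_as)) =
    four_block_mat (shifted w (jordan_block n a)) (0\<^sub>m n ?N) (0\<^sub>m ?N n) (shifted w (jordan_matrix n_as))"
    by (intro eq_matI) (auto simp: na jordan_matrix_Cons shifted_def)
  have S: "shifted w (jordan_block n a) \<in> carrier_mat n n"
    "shifted w (jordan_matrix n_as) \<in> carrier_mat ?N ?N"
    by (auto intro!: shifted_carrier)
  have "shifted w (jordan_matrix (na # n_as)) * fun_jordan_matrix ?g (na # n_as) =
    four_block_mat (1\<^sub>m n) (0\<^sub>m n ?N) (0\<^sub>m ?N n) (1\<^sub>m ?N)"
    unfolding shifted unfolding na fun_jordan_matrix_Cons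
    by (subst mult_four_block_mat[OF S(1) _ _ S(2) fun_jordan_block_carrier _ _
          fun_jordan_matrix_carrier])
       (use S Cons fun_jordan_matrix_carrier[of ?g n_as] fun_jordan_block_carrier[of ?g n a]
        in \<open>auto simp: na jordan_block_resolvent right_mult_zero_mat[OF S(1)]
          right_mult_zero_mat[OF S(2)] left_mult_zero_mat[OF fun_jordan_block_carrier]\<close>)
  also have "\<dots> = 1\<^sub>m (n + ?N)" by simp
  finally show ?case by (simp add: na)
qed

lemma similar_resolvent:
  assumes A: "A \<in> carrier_mat m m" and sim: "similar_mat_wit A (jordan_matrix n_as) V W"
    and w: "w \<notin> snd ` set n_as"
  shows "shifted w A * (V * fun_jordan_matrix (\<lambda>x. 1 / (w - x)) n_as * W) = 1\<^sub>m m"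
proof -
  note wit = similar_mat_witD2[OF A sim]
  let ?J = "jordan_matrix n_as" and ?F = "fun_jordan_matrix (\<lambda>x. 1 / (w - x)) n_as"
  have m: "sum_list (map fst n_as) = m" using wit(5) by auto
  have F: "?F \<in> carrier_mat m m" using fun_jordan_matrix_carrier[of _ n_as] by (simp add: m)
  have SJ: "shifted w ?J \<in> carrier_mat m m" using wit(5) by (rule shifted_carrier)
  have wJ: "w \<cdot>\<^sub>m 1\<^sub>m m \<in> carrier_mat m m" by simp
  have "V * shifted w ?J = V * (w \<cdot>\<^sub>m 1\<^sub>m m) - V * ?J"
    unfolding shifted_def using m by (simp add: mult_minus_distrib_mat[OF wit(6) wJ wit(5)])
  also have "V * (w \<cdot>\<^sub>m 1\<^sub>m m) = w \<cdot>\<^sub>m V"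
    using mult_smult_distrib[OF wit(6) one_carrier_mat] wit(6) by simp
  finally have "V * shifted w ?J * W = (w \<cdot>\<^sub>m V) * W - V * ?J * W"
    using wit(5-7) by (simp add: minus_mult_distrib_mat[of _ m m _ W m] del: assoc_mult_mat)
  also have "(w \<cdot>\<^sub>m V) * W = w \<cdot>\<^sub>m 1\<^sub>m m"
    using mult_smult_assoc_mat[OF wit(6) wit(7)] wit(1) by simp
  finally have S: "shifted w A = V * shifted w ?J * W"
    using A by (simp add: shifted_def wit(3)[symmetric])
  have "shifted w A * (V * ?F * W) = V * shifted w ?J * (W * (V * (?F * W)))"
    unfolding S using wit F SJ by (simp add: assoc_mult_mat[of _ m m _ m _ m])
  also have "W * (V * (?F * W)) = W * V * (?F * W)"
    using wit F by (subst assoc_mult_mat[of _ m m _ m _ m]) auto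
  also have "V * shifted w ?J * (W * V * (?F * W)) = V * (shifted w ?J * ?F) * W"
    using wit F SJ by (simp add: assoc_mult_mat[of _ m m _ m _ m])
  also have "\<dots> = 1\<^sub>m m"
    using wit jordan_matrix_resolvent[OF w] by (simp add: m)
  finally show ?thesis .
qed

lemma jordan_decomposition_exists:
  fixes A :: "complex mat"
  assumes A: "A \<in> carrier_mat m m"
  obtains n_as V W where "0 \<notin> fst ` set n_as" "similar_mat_wit A (jordan_matrix n_as) V W"
proof -
  obtain as where "char_poly A = (\<Prod>a\<leftarrow>as. [:- a, 1:])"
    using char_poly_factorized[OF A] by blast
  with jordan_nf_exists[OF A] obtain n_as where "jordan_nf A n_as" by blast
  with that show thesis unfolding jordan_nf_def similar_mat_def by blast
qed

section \<open>Residues\<close>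

lemma residue_lincomb:
  assumes "finite X" "open U" "p \<in> U" "\<And>x. x \<in> X \<Longrightarrow> g x holomorphic_on U - {p}"
  shows "residue (\<lambda>w. \<Sum>x\<in>X. c x * g x w) p = (\<Sum>x\<in>X. c x * residue (g x) p)"
  using assms
proof (induction X rule: finite_induct)
  case (insert x X)
  have "residue (\<lambda>w. c x * g x w + (\<Sum>x\<in>X. c x * g x w)) p =
    residue (\<lambda>w. c x * g x w) p + residue (\<lambda>w. \<Sum>x\<in>X. c x * g x w) p"
    using insert.prems by (intro residue_add[of U] holomorphic_intros) auto
  also have "residue (\<lambda>w. c x * g x w) p = c x * residue (g x) p"
    using insert.prems by (intro residue_lmul[of U]) auto
  finally show ?case using insert by simp
qed (simp add: residue_const)

text \<open>
  Only the Taylor polynomial of \<open>r\<close> of degree below \<open>d\<close> matters when the pole of \<open>f\<close> has order at most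
  \<open>d\<close>: in the product with \<open>f\<close>, the remainder becomes the holomorphic function \<open>h * s\<close>. The term of degree \<open>l\<close> meets the
  coefficient of \<open>f\<close> at \<open>(w - p) ^ (- Suc l)\<close>, which is a Taylor coefficient of \<open>h\<close>.
\<close>

lemma residue_mult_truncated_taylor:
  assumes U: "open U" "p \<in> U" and h: "h holomorphic_on U" and s: "s holomorphic_on U"
    and f: "\<And>w. w \<in> U - {p} \<Longrightarrow> f w = h w / (w - p) ^ d"
    and r: "\<And>w. w \<in> U - {p} \<Longrightarrow> r w = (\<Sum>l<d. c l * (w - p) ^ l) + (w - p) ^ d * s w"
  shows "residue (\<lambda>w. f w * r w) p =
    (\<Sum>l<d. c l * ((deriv ^^ (d - Suc l)) h p / fact (d - Suc l)))"
proof -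
  let ?q = "\<lambda>l w. h w / (w - p) ^ Suc (d - Suc l)"
  have "f w * r w = (\<Sum>l<d. c l * ?q l w) + h w * s w" if w: "w \<in> U - {p}" for w
  proof -
    have "h w / (w - p) ^ d * (c l * (w - p) ^ l) = c l * ?q l w" if "l < d" for l
    proof -
      have "d = l + Suc (d - Suc l)" using that by simp
      then have "(w - p) ^ d = (w - p) ^ l * (w - p) ^ Suc (d - Suc l)"
        by (metis power_add)
      with w show ?thesis by simp
    qed
    then have "(\<Sum>l<d. h w / (w - p) ^ d * (c l * (w - p) ^ l)) = (\<Sum>l<d. c l * ?q l w)"
      by simp
    moreover have "h w / (w - p) ^ d * ((w - p) ^ d * s w) = h w * s w"
      using w by simp
    ultimately show ?thesis
      by (simp only: f[OF w] r[OF w] distrib_left sum_distrib_left)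
  qed
  then have "eventually (\<lambda>w. f w * r w = (\<Sum>l<d. c l * ?q l w) + h w * s w) (at p)"
    using eventually_at_in_open[OF U] by (auto elim: eventually_mono)
  then have "residue (\<lambda>w. f w * r w) p = residue (\<lambda>w. (\<Sum>l<d. c l * ?q l w) + h w * s w) p"
    by (intro residue_cong) auto
  also have "\<dots> = residue (\<lambda>w. \<Sum>l<d. c l * ?q l w) p + residue (\<lambda>w. h w * s w) p"
    using U by (intro residue_add[of U] holomorphic_intros)
      (auto intro: holomorphic_on_subset[OF h] holomorphic_on_subset[OF s])
  also have "residue (\<lambda>w. h w * s w) p = 0"
    using U h s by (intro residue_holo[of U] holomorphic_intros)
  also have "residue (\<lambda>w. \<Sum>l<d. c l * ?q l w) p = (\<Sum>l<d. c l * residue (?q l) p)"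
    using U by (intro residue_lincomb[of _ U] holomorphic_intros)
      (auto intro: holomorphic_on_subset[OF h])
  also have "\<dots> = (\<Sum>l<d. c l * ((deriv ^^ (d - Suc l)) h p / fact (d - Suc l)))"
    unfolding residue_holomorphic_over_power[OF U h] ..
  finally show ?thesis by simp
qed

text \<open>
  Near \<open>p\<close> the function agrees with the holomorphic factor \<open>zor_poly f p\<close> of \<open>f\<close>. Hence the limit that is its
  value at \<open>p\<close> exists, and the singularity is removed.
\<close>

lemma pole_cleared_holomorphic:
  assumes U: "open U" "p \<in> U" and f: "f holomorphic_on U - {p}" and pole: "is_pole f p"
    and d: "int d = - zorder f p"
  shows "pole_cleared f p d holomorphic_on U"
proof -
  define g where "g = zor_poly f p"
  have d': "nat (- zorder f p) = d" using d by simp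
  obtain r where r: "r > 0" "cball p r \<subseteq> U" and g: "g holomorphic_on cball p r"
    and fg: "\<forall>w\<in>cball p r - {p}. f w = g w / (w - p) ^ d"
    using zorder_exist_pole[OF f U pole] unfolding g_def d' by blast
  have clear: "(w - p) ^ d * f w = g w" if "w \<in> ball p r - {p}" for w
    using that fg by auto
  have "isCont g p"
    using holomorphic_on_imp_continuous_on[OF g] r(1) continuous_on_interior[of "cball p r" g p]
    by simp
  then have "(g \<longlongrightarrow> g p) (at p)" by (simp add: isCont_def)
  moreover have "eventually (\<lambda>w. g w = (w - p) ^ d * f w) (at p)"
    using eventually_at_in_open[of "ball p r" p] r(1) clear by (auto elim: eventually_mono)
  ultimately have "((\<lambda>w. (w - p) ^ d * f w) \<longlongrightarrow> g p) (at p)"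
    by (rule Lim_transform_eventually)
  then have "Lim (at p) (\<lambda>w. (w - p) ^ d * f w) = g p"
    by (intro tendsto_Lim) auto
  then have "pole_cleared f p d w = g w" if "w \<in> ball p r" for w
    using clear that by (auto simp: pole_cleared_def)
  moreover have "g holomorphic_on ball p r"
    using g by (rule holomorphic_on_subset) auto
  ultimately have 1: "pole_cleared f p d holomorphic_on ball p r"
    by (subst holomorphic_cong[OF refl]) auto
  have "(\<lambda>w. (w - p) ^ d * f w) holomorphic_on U - {p}"
    using f by (intro holomorphic_intros)
  then have 2: "pole_cleared f p d holomorphic_on U - {p}"
    by (subst holomorphic_cong[OF refl]) (auto simp: pole_cleared_def)
  have "U = ball p r \<union> (U - {p})" using r U(2) by (auto simp: dist_commute)
  then show ?thesis
    using holomorphic_on_Un[OF 1 2] U(1) by auto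
qed

lemma poles_sparse:
  assumes "f meromorphic_on UNIV"
  shows "{w. is_pole f w} sparse_in UNIV"
proof (rule sparse_in_subset2[OF meromorphic_on_imp_sparse_singularities[OF assms]])
  show "{w. is_pole f w} \<subseteq> {w. \<not> f analytic_on {w}}"
    by (auto simp: analytic_at dest: not_is_pole_holomorphic)
qed

text \<open>
  The residue theorem needs a connected open domain around which the curve does not wind. It is
  obtained by removing from the plane the points of \<open>Q\<close> outside the curve, possibly infinitely many:
  a sparse set is closed, and removing it does not disconnect the plane.
\<close>

lemma residue_theorem_sparse:
  assumes curve: "simple_closed_curve \<gamma>" "positively_oriented \<gamma>"
    and Q: "Q sparse_in UNIV" and g: "g holomorphic_on - Q"
    and avoid: "path_image \<gamma> \<inter> Q = {}" and fin: "finite (Q \<inter> inside (path_image \<gamma>))"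
  shows "contour_integral \<gamma> g =
    2 * of_real pi * \<i> * (\<Sum>p\<in>Q \<inter> inside (path_image \<gamma>). residue g p)"
proof -
  let ?in = "inside (path_image \<gamma>)"
  have \<gamma>: "valid_path \<gamma>" "pathfinish \<gamma> = pathstart \<gamma>" "path \<gamma>"
    using curve(1) by (auto simp: simple_closed_curve_def valid_path_imp_path)
  define D where "D = UNIV - (Q - ?in)"
  have sparse: "(Q - ?in) sparse_in UNIV"
    using Q by (rule sparse_in_subset2) auto
  have D: "open D" "connected D"
    unfolding D_def using sparse
    by (auto intro!: open_diff_sparse_pts sparse_imp_connected connected_UNIV)
  have "contour_integral \<gamma> g =
    2 * pi * \<i> * (\<Sum>p\<in>Q \<inter> ?in. winding_number \<gamma> p * residue g p)"
  proof (rule Residue_theorem[OF D fin])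
    show "g holomorphic_on D - (Q \<inter> ?in)"
      using g by (rule holomorphic_on_subset) (auto simp: D_def)
    show "path_image \<gamma> \<subseteq> D - (Q \<inter> ?in)"
      using avoid by (auto simp: D_def)
    show "\<forall>w. w \<notin> D \<longrightarrow> winding_number \<gamma> w = 0"
    proof (intro allI impI)
      fix w assume "w \<notin> D"
      then have "w \<notin> path_image \<gamma>" "w \<notin> ?in"
        using avoid by (auto simp: D_def)
      then have "w \<in> outside (path_image \<gamma>)"
        by (metis ComplI UnE inside_Un_outside)
      then show "winding_number \<gamma> w = 0"
        using \<gamma> by (intro winding_number_zero_in_outside)
    qed
  qed (use \<gamma> in auto)
  also have "(\<Sum>p\<in>Q \<inter> ?in. winding_number \<gamma> p * residue g p) = (\<Sum>p\<in>Q \<inter> ?in. residue g p)"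
    using curve(2) by (intro sum.cong) (auto simp: positively_oriented_def)
  finally show ?thesis by simp
qed

text \<open>
  For an entry that is the Taylor coefficient of order \<open>s\<close> at the eigenvalue \<open>a\<close>, the function
  inside the residue is \<open>f w / (w - a) ^ Suc s\<close>. Its residue at \<open>a\<close> is that Taylor coefficient of \<open>f\<close>,
  and at the other eigenvalues it is holomorphic.
\<close>

lemma sum_residues_jordan_matrix:
  assumes D: "open D" "snd ` set n_as \<subseteq> D" and f: "f holomorphic_on D"
    and ik: "i < sum_list (map fst n_as)" "k < sum_list (map fst n_as)"
  shows "(\<Sum>\<mu>\<in>snd ` set n_as.
      residue (\<lambda>w. f w * fun_jordan_matrix (\<lambda>x. 1 / (w - x)) n_as $$ (i, k)) \<mu>) =
    fun_jordan_matrix f n_as $$ (i, k)"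
  using ik
proof (cases rule: reciprocal_jordan_matrix_index_cases)
  case (2 a s)
  let ?r = "\<lambda>w. f w * fun_jordan_matrix (\<lambda>x. 1 / (w - x)) n_as $$ (i, k)"
  have r: "?r w = f w / (w - a) ^ Suc s" if "w \<noteq> a" for w
    using 2(3)[OF that] by simp
  have at_a: "residue ?r a = (deriv ^^ s) f a / fact s"
  proof -
    have "eventually (\<lambda>w. ?r w = f w / (w - a) ^ Suc s) (at a)"
      using r by (auto simp: eventually_at_filter)
    then have "residue ?r a = residue (\<lambda>w. f w / (w - a) ^ Suc s) a"
      by (intro residue_cong) auto
    with residue_holomorphic_over_power[OF D(1) _ f, of a s] 2(1) D(2) show ?thesis by auto
  qed
  have away: "residue ?r \<mu> = 0" if "\<mu> \<in> snd ` set n_as - {a}" for \<mu>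
  proof (rule residue_holo)
    show "open (D - {a})" using D(1) by auto
    show "\<mu> \<in> D - {a}" using that D(2) by auto
    have "(\<lambda>w. f w / (w - a) ^ Suc s) holomorphic_on D - {a}"
      by (intro holomorphic_intros holomorphic_on_subset[OF f]) auto
    then show "?r holomorphic_on D - {a}"
      by (subst holomorphic_cong[OF refl r]) auto
  qed
  have "(\<Sum>\<mu>\<in>snd ` set n_as. residue ?r \<mu>) = residue ?r a + (\<Sum>\<mu>\<in>snd ` set n_as - {a}. residue ?r \<mu>)"
    using 2(1) by (intro sum.remove) auto
  also have "(\<Sum>\<mu>\<in>snd ` set n_as - {a}. residue ?r \<mu>) = 0"
    using away by (rule sum.neutral[rule_format])
  finally show ?thesis using at_a 2(2)[of f] by (simp only: add_0_right)
qed (simp add: residue_const)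

section \<open>The resolvent of a matrix with a given Jordan decomposition\<close>

locale jordan_decomposed =
  fixes A :: "complex mat" and m :: nat and n_as :: "(nat \<times> complex) list" and V W :: "complex mat"
  assumes A: "A \<in> carrier_mat m m"
    and no_empty_block: "0 \<notin> fst ` set n_as"
    and sim: "similar_mat_wit A (jordan_matrix n_as) V W"
begin

abbreviation "eigenvalues \<equiv> snd ` set n_as"

definition resolvent :: "complex \<Rightarrow> complex mat" where
  "resolvent w = V * fun_jordan_matrix (\<lambda>x. 1 / (w - x)) n_as * W"

lemma V: "V \<in> carrier_mat m m" and W: "W \<in> carrier_mat m m"
  using similar_mat_witD2[OF A sim] by auto

lemma size_sum: "sum_list (map fst n_as) = m"
  using carrier_matD(1)[OF similar_mat_witD2(5)[OF A sim]] by simp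

lemma fun_jordan_carrier: "fun_jordan_matrix f n_as \<in> carrier_mat m m"
  using fun_jordan_matrix_carrier[of f n_as] by (simp add: size_sum)

lemma eigenvalues_subset_spectrum: "eigenvalues \<subseteq> spectrum A"
proof
  fix a assume "a \<in> eigenvalues"
  then obtain n where n: "(n, a) \<in> set n_as" by force
  with no_empty_block have "n \<noteq> 0" by force
  have "jordan_nf A n_as"
    using sim no_empty_block unfolding jordan_nf_def similar_mat_def by blast
  then have "char_poly A = (\<Prod>(n, a)\<leftarrow>n_as. [:- a, 1:] ^ n)"
    by (rule jordan_nf_char_poly)
  then have "poly (char_poly A) a = (\<Prod>(n, b)\<leftarrow>n_as. (a - b) ^ n)"
    by (simp add: poly_prod_list o_def case_prod_unfold)
  also have "\<dots> = 0"
  proof -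
    have "(0::complex) = (case (n, a) of (n, b) \<Rightarrow> (a - b) ^ n)" using \<open>n \<noteq> 0\<close> by simp
    then have "0 \<in> set (map (\<lambda>(n, b). (a - b) ^ n) n_as)" using n by (metis image_eqI set_map)
    then show ?thesis by (simp add: prod_list_zero_iff)
  qed
  finally show "a \<in> spectrum A"
    by (simp add: spectrum_root_char_poly[OF A])
qed

lemma resolvent_carrier: "resolvent w \<in> carrier_mat m m"
  unfolding resolvent_def using V W fun_jordan_carrier by (intro mult_carrier_mat)

lemma shifted_resolvent: "w \<notin> eigenvalues \<Longrightarrow> shifted w A * resolvent w = 1\<^sub>m m"
  unfolding resolvent_def by (rule similar_resolvent[OF A sim])

lemma matrix_inverse_shifted:
  assumes "w \<notin> eigenvalues"
  shows "matrix_inverse (shifted w A) = resolvent w"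
  by (rule matrix_inverse_eqI[OF shifted_carrier[OF A] resolvent_carrier shifted_resolvent[OF assms]])

text \<open>
  The factor \<open>B\<close> is present because the remainder of the expansion of the resolvent at a pole is, up to
  sign, such a product with \<open>B\<close> a power of \<open>matrix_inverse (shifted p A)\<close>.
\<close>

lemma mult_resolvent_holomorphic:
  assumes B: "B \<in> carrier_mat m m" and ik: "i < m" "k < m"
  shows "(\<lambda>w. (B * resolvent w) $$ (i, k)) holomorphic_on - eigenvalues"
proof -
  have "B * resolvent w = B * V * fun_jordan_matrix (\<lambda>x. 1 / (w - x)) n_as * W" for w
  proof -
    note F = fun_jordan_carrier[of "\<lambda>x. 1 / (w - x)"]
    have "B * resolvent w = B * (V * fun_jordan_matrix (\<lambda>x. 1 / (w - x)) n_as) * W"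
      unfolding resolvent_def
      using assoc_mult_mat[OF B mult_carrier_mat[OF V F] W] by simp
    then show ?thesis using assoc_mult_mat[OF B V F] by simp
  qed
  then have "(B * resolvent w) $$ (i, k) = (\<Sum>(a, b)\<in>{..<m} \<times> {..<m}.
      (B * V) $$ (i, a) * W $$ (b, k) * fun_jordan_matrix (\<lambda>x. 1 / (w - x)) n_as $$ (a, b))" for w
    using triple_product_index[OF mult_carrier_mat[OF B V] fun_jordan_carrier W ik] by simp
  moreover have "(\<lambda>w. \<Sum>(a, b)\<in>{..<m} \<times> {..<m}. (B * V) $$ (i, a) * W $$ (b, k) *
      fun_jordan_matrix (\<lambda>x. 1 / (w - x)) n_as $$ (a, b)) holomorphic_on - eigenvalues"
    unfolding case_prod_unfold
    by (intro holomorphic_intros reciprocal_jordan_matrix_holomorphic) (auto simp: size_sum)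
  ultimately show ?thesis by simp
qed

lemma resolvent_holomorphic:
  assumes ik: "i < m" "k < m"
  shows "(\<lambda>w. resolvent w $$ (i, k)) holomorphic_on - eigenvalues"
  using mult_resolvent_holomorphic[OF one_carrier_mat ik]
  by (simp add: left_mult_one_mat[OF resolvent_carrier])

text \<open>
  The expansion of the resolvent at \<open>p\<close> has the coefficients \<open>(-1) ^ l * N ^ Suc l\<close>, where \<open>N\<close> is
  the inverse of \<open>p I - A\<close>. They are paired with the coefficients of the principal part of \<open>f\<close>,
  which up to these signs are the coefficients of \<open>R\<close>; the power \<open>N ^ Suc l\<close> is \<open>z ^ (- Suc l)\<close> at \<open>z = p I - A\<close>.
\<close>

lemma residue_resolvent_at_pole:
  assumes U: "open U" "p \<in> U" "U \<subseteq> - eigenvalues"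
    and f: "f holomorphic_on U - {p}" "is_pole f p" and d: "int d = - zorder f p"
    and ik: "i < m" "k < m"
  shows "residue (\<lambda>w. f w * resolvent w $$ (i, k)) p = R_matrix m f p d (shifted p A) $$ (i, k)"
proof -
  define N where "N = matrix_inverse (shifted p A)"
  define a where "a = (\<lambda>l. (N ^\<^sub>m Suc l) $$ (i, k))"
  have p: "p \<notin> eigenvalues" using U by auto
  have N: "N \<in> carrier_mat m m"
    using resolvent_carrier by (simp add: N_def matrix_inverse_shifted[OF p])
  have NA: "N * shifted p A = 1\<^sub>m m"
    using mat_mult_left_right_inverse[OF shifted_carrier[OF A] resolvent_carrier
      shifted_resolvent[OF p]]
    by (simp add: N_def matrix_inverse_shifted[OF p])
  have expand: "resolvent w $$ (i, k) =
    (\<Sum>l<d. (- 1) ^ l * a l * (w - p) ^ l) +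
      (w - p) ^ d * ((- 1) ^ d * (N ^\<^sub>m d * resolvent w) $$ (i, k))"
    if w: "w \<in> U - {p}" for w
  proof -
    have "w \<notin> eigenvalues" using w U by auto
    then have "(N ^\<^sub>m l * resolvent w) $$ (i, k) =
        a l - (w - p) * (N ^\<^sub>m Suc l * resolvent w) $$ (i, k)" for l
      unfolding a_def
      by (intro resolvent_expansion_step[OF A N resolvent_carrier NA shifted_resolvent ik])
    from alternating_expansion[of "\<lambda>l. (N ^\<^sub>m l * resolvent w) $$ (i, k)", OF this, of d]
    have "(N ^\<^sub>m 0 * resolvent w) $$ (i, k) = (\<Sum>l<d. (- (w - p)) ^ l * a l) +
      (- (w - p)) ^ d * (N ^\<^sub>m d * resolvent w) $$ (i, k)" .
    moreover have "N ^\<^sub>m 0 * resolvent w = resolvent w"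
      using carrier_matD(1)[OF N] left_mult_one_mat[OF resolvent_carrier] by simp
    moreover have "(- (w - p)) ^ l = (- 1) ^ l * (w - p) ^ l" for l
      by (rule power_minus)
    ultimately show ?thesis by (simp only: ac_simps)
  qed
  have "residue (\<lambda>w. f w * resolvent w $$ (i, k)) p = (\<Sum>l<d. (- 1) ^ l * a l *
      ((deriv ^^ (d - Suc l)) (pole_cleared f p d) p / fact (d - Suc l)))"
  proof (rule residue_mult_truncated_taylor[OF U(1,2) pole_cleared_holomorphic[OF U(1,2) f d]])
    show "(\<lambda>w. (- 1) ^ d * (N ^\<^sub>m d * resolvent w) $$ (i, k)) holomorphic_on U"
      using N U(3) ik
      by (intro holomorphic_intros holomorphic_on_subset[OF mult_resolvent_holomorphic]
        pow_carrier_mat)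
    show "f w = pole_cleared f p d w / (w - p) ^ d" if "w \<in> U - {p}" for w
      using that by (simp add: pole_cleared_def)
  qed (rule expand)
  also have "\<dots> = (\<Sum>l<d. R_coeff f p d (Suc l) * (N ^\<^sub>m Suc l) $$ (i, k))"
    by (intro sum.cong) (simp_all add: R_coeff_def a_def)
  also have "\<dots> = (\<Sum>l\<in>{1..d}. R_coeff f p d l * (N ^\<^sub>m l) $$ (i, k))"
    by (simp add: sum.atLeast1_atMost_eq del: pow_mat.simps)
  also have "\<dots> = (\<Sum>l\<in>{1..d}. (R_coeff f p d l \<cdot>\<^sub>m (N ^\<^sub>m l)) $$ (i, k))"
    using N ik by (intro sum.cong refl index_smult_mat(1)[symmetric]) auto
  also have "\<dots> = R_matrix m f p d (shifted p A) $$ (i, k)"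
    unfolding R_matrix_def N_def[symmetric] using N ik
    by (intro matrix_sum_index[symmetric]) auto
  finally show ?thesis .
qed

text \<open>
  Residues are linear in the entries of the resolvent, and both sides come from functions of the
  Jordan matrix by the same multiplication with \<open>V\<close> and \<open>W\<close>. This reduces the claim to the
  entries of a Jordan matrix.
\<close>

lemma sum_residues_resolvent:
  assumes D: "open D" "eigenvalues \<subseteq> D" and f: "f holomorphic_on D"
    and ik: "i < m" "k < m"
  shows "(\<Sum>\<mu>\<in>eigenvalues. residue (\<lambda>w. f w * resolvent w $$ (i, k)) \<mu>) =
    (V * fun_jordan_matrix f n_as * W) $$ (i, k)"
proof -
  let ?F = "\<lambda>w. fun_jordan_matrix (\<lambda>x. 1 / (w - x)) n_as"
  let ?I = "{..<m} \<times> {..<m}"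
  define c where "c = (\<lambda>ab. V $$ (i, fst ab) * W $$ (snd ab, k))"
  have entry: "(V * G * W) $$ (i, k) = (\<Sum>ab\<in>?I. c ab * G $$ ab)"
    if "G \<in> carrier_mat m m" for G
    using triple_product_index[OF V that W ik] by (simp add: c_def case_prod_unfold)
  have "f w * resolvent w $$ (i, k) = (\<Sum>ab\<in>?I. c ab * (f w * ?F w $$ ab))" for w
    by (simp add: resolvent_def entry[OF fun_jordan_carrier] sum_distrib_left ac_simps)
  then have "residue (\<lambda>w. f w * resolvent w $$ (i, k)) \<mu> =
      (\<Sum>ab\<in>?I. c ab * residue (\<lambda>w. f w * ?F w $$ ab) \<mu>)" if \<mu>: "\<mu> \<in> eigenvalues" for \<mu>
  proof -
    let ?U = "D - (eigenvalues - {\<mu>})"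
    have "(\<lambda>w. f w * ?F w $$ ab) holomorphic_on ?U - {\<mu>}" if "ab \<in> ?I" for ab
      using that f D
      by (cases ab) (auto intro!: holomorphic_intros holomorphic_on_subset[OF f]
        holomorphic_on_subset[OF reciprocal_jordan_matrix_holomorphic] simp: size_sum)
    moreover have "open ?U" using D(1) by (intro open_Diff finite_imp_closed) auto
    moreover have "\<mu> \<in> ?U" using \<mu> D(2) by auto
    ultimately have "residue (\<lambda>w. \<Sum>ab\<in>?I. c ab * (f w * ?F w $$ ab)) \<mu> =
      (\<Sum>ab\<in>?I. c ab * residue (\<lambda>w. f w * ?F w $$ ab) \<mu>)"
      by (intro residue_lincomb[of _ ?U]) auto
    then show ?thesis
      using \<open>\<And>w. f w * resolvent w $$ (i, k) = _ w\<close> by simp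
  qed
  then have "(\<Sum>\<mu>\<in>eigenvalues. residue (\<lambda>w. f w * resolvent w $$ (i, k)) \<mu>) =
      (\<Sum>\<mu>\<in>eigenvalues. \<Sum>ab\<in>?I. c ab * residue (\<lambda>w. f w * ?F w $$ ab) \<mu>)"
    by simp
  also have "\<dots> = (\<Sum>ab\<in>?I. c ab * (\<Sum>\<mu>\<in>eigenvalues. residue (\<lambda>w. f w * ?F w $$ ab) \<mu>))"
    by (subst sum.swap) (simp add: sum_distrib_left)
  also have "\<dots> = (\<Sum>ab\<in>?I. c ab * fun_jordan_matrix f n_as $$ ab)"
    using sum_residues_jordan_matrix[OF D f] by (intro sum.cong) (auto simp: size_sum)
  also have "\<dots> = (V * fun_jordan_matrix f n_as * W) $$ (i, k)"
    by (rule entry[OF fun_jordan_carrier, symmetric])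
  finally show ?thesis .
qed

end

section \<open>The contour integral of the resolvent\<close>

lemma R_matrix_carrier:
  assumes "matrix_inverse M \<in> carrier_mat m m"
  shows "R_matrix m f p d M \<in> carrier_mat m m"
  unfolding R_matrix_def using assms by (intro matrix_sum_carrier) auto

text \<open>
  The formula with the matrix function replaced by the matrix built from one Jordan decomposition,
  which is arbitrary. The singularities of an entry of the integrand lie in the sparse set of the
  poles and the eigenvalues, of which the curve encloses all eigenvalues and the given poles.
\<close>

lemma contour_integral_resolvent:
  fixes f :: "complex \<Rightarrow> complex" and A :: "complex mat" and z :: "nat \<Rightarrow> complex"
  assumes mero: "f meromorphic_on UNIV" and P: "P = {w. is_pole f w}"
    and holo: "f holomorphic_on - P" and A: "A \<in> carrier_mat m m"
    and specP: "spectrum A \<inter> P = {}"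
    and curve: "simple_closed_curve \<gamma>" "positively_oriented \<gamma>"
    and avoid: "path_image \<gamma> \<inter> P = {}" and spec: "spectrum A \<subseteq> inside (path_image \<gamma>)"
    and z: "inj_on z {1..t}" "z ` {1..t} = P \<inter> inside (path_image \<gamma>)"
    and d: "\<forall>j\<in>{1..t}. int (d j) = - zorder f (z j)"
    and nz: "0 \<notin> fst ` set n_as" and sim: "similar_mat_wit A (jordan_matrix n_as) V W"
  shows "(1 / (2 * of_real pi * \<i>)) \<cdot>\<^sub>m
      matrix_contour_integral m \<gamma> (\<lambda>w. f w \<cdot>\<^sub>m matrix_inverse (shifted w A)) =
    V * fun_jordan_matrix f n_as * W +
      matrix_sum m (\<lambda>j. R_matrix m f (z j) (d j) (shifted (z j) A)) {1..t}"
    (is "?c \<cdot>\<^sub>m ?I = ?F + ?S")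
proof -
  interpret jordan_decomposed A m n_as V W
    using A nz sim by unfold_locales
  let ?in = "inside (path_image \<gamma>)"
  define T where "T = z ` {1..t}"
  have ev: "eigenvalues \<subseteq> ?in" "eigenvalues \<inter> P = {}"
    using eigenvalues_subset_spectrum spec specP by auto
  have T: "T = P \<inter> ?in" "finite T" unfolding T_def by (rule z(2), simp)
  have ev_path: "eigenvalues \<inter> path_image \<gamma> = {}"
    using ev(1) inside_no_overlap[of "path_image \<gamma>"] by blast
  have P_sparse: "P sparse_in UNIV" unfolding P by (rule poles_sparse[OF mero])
  then have P_open: "open (- P)" using sparse_in_UNIV_imp_closed by auto
  have R_carrier: "R_matrix m f (z j) (d j) (shifted (z j) A) \<in> carrier_mat m m"
    if "j \<in> {1..t}" for j
  proof -
    have "z j \<in> P" using that T(1) unfolding T_def by blast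
    then have "z j \<notin> eigenvalues" using ev(2) by blast
    then show ?thesis
      by (intro R_matrix_carrier) (simp add: matrix_inverse_shifted resolvent_carrier)
  qed
  have F: "?F \<in> carrier_mat m m"
    using V W fun_jordan_carrier by (intro mult_carrier_mat)
  have S: "?S \<in> carrier_mat m m"
    using R_carrier by (intro matrix_sum_carrier) auto
  show ?thesis
  proof (rule eq_matI)
    fix i k assume "i < dim_row (?F + ?S)" "k < dim_col (?F + ?S)"
    then have ik: "i < m" "k < m" using S by auto
    let ?g = "\<lambda>w. f w * resolvent w $$ (i, k)"
    have at_pole: "residue ?g (z j) = R_matrix m f (z j) (d j) (shifted (z j) A) $$ (i, k)"
      if j: "j \<in> {1..t}" for j
    proof -
      have zj: "z j \<in> P" using j T(1) unfolding T_def by blast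
      let ?U = "- (P - {z j}) - eigenvalues"
      have "closed (P - {z j})"
        using P_sparse by (intro sparse_in_UNIV_imp_closed) (rule sparse_in_subset2, auto)
      moreover have "closed eigenvalues" by (simp add: finite_imp_closed)
      ultimately have "open ?U" by (intro open_Diff open_Compl)
      then show ?thesis
        using zj ev(2) d j P ik holo
        by (intro residue_resolvent_at_pole[of ?U]) (auto intro: holomorphic_on_subset)
    qed
    have holo_g: "?g holomorphic_on - (P \<union> eigenvalues)"
      using resolvent_holomorphic[OF ik] holo
      by (auto intro!: holomorphic_intros intro: holomorphic_on_subset)
    have Q: "(P \<union> eigenvalues) \<inter> ?in = eigenvalues \<union> T"
      using ev T by auto
    have "?I $$ (i, k) = contour_integral \<gamma> (\<lambda>w. (f w \<cdot>\<^sub>m matrix_inverse (shifted w A)) $$ (i, k))"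
      using ik by (simp add: matrix_contour_integral_def)
    also have "\<dots> = contour_integral \<gamma> ?g"
    proof (rule contour_integral_eq)
      fix w assume "w \<in> path_image \<gamma>"
      then have "w \<notin> eigenvalues" using ev_path by auto
      then show "(f w \<cdot>\<^sub>m matrix_inverse (shifted w A)) $$ (i, k) = ?g w"
        using ik carrier_matD[OF resolvent_carrier] by (simp add: matrix_inverse_shifted)
    qed
    also have "\<dots> = 2 * of_real pi * \<i> * (\<Sum>p\<in>eigenvalues \<union> T. residue ?g p)"
      unfolding Q[symmetric]
    proof (rule residue_theorem_sparse[OF curve _ holo_g])
      show "(P \<union> eigenvalues) sparse_in UNIV"
        by (intro sparse_in_union' P_sparse finite_imp_sparse[of eigenvalues]) simp
      show "path_image \<gamma> \<inter> (P \<union> eigenvalues) = {}" using avoid ev_path by auto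
      show "finite ((P \<union> eigenvalues) \<inter> ?in)" unfolding Q using T(2) by auto
    qed
    also have "(\<Sum>p\<in>eigenvalues \<union> T. residue ?g p) =
        (\<Sum>p\<in>eigenvalues. residue ?g p) + (\<Sum>p\<in>T. residue ?g p)"
      using T ev(2) by (intro sum.union_disjoint) auto
    also have "(\<Sum>p\<in>eigenvalues. residue ?g p) = ?F $$ (i, k)"
      using ev(2) by (intro sum_residues_resolvent[OF P_open _ holo ik]) auto
    also have "(\<Sum>p\<in>T. residue ?g p) = (\<Sum>j\<in>{1..t}. residue ?g (z j))"
      unfolding T_def using z(1) by (simp add: sum.reindex)
    also have "\<dots> = ?S $$ (i, k)"
      using at_pole by (subst matrix_sum_index[OF _ R_carrier ik]) auto
    finally have "?I $$ (i, k) = 2 * of_real pi * \<i> * (?F $$ (i, k) + ?S $$ (i, k))" .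
    moreover have "dim_row ?I = m" "dim_col ?I = m" by (simp_all add: matrix_contour_integral_def)
    ultimately show "(?c \<cdot>\<^sub>m ?I) $$ (i, k) = (?F + ?S) $$ (i, k)"
      using ik carrier_matD[OF F] carrier_matD[OF S] by simp
  qed (use S in \<open>auto simp: matrix_contour_integral_def\<close>)
qed

text \<open>
  Cancelling the sum over the poles in the formulas for two Jordan decompositions shows that both
  yield the same matrix, so the definite description denotes it. For simple poles the sum
  defining \<open>R\<close> has the single term \<open>l = 1\<close>, in which the sign is positive.
\<close>

theorem theorem4p1:
  fixes f :: "complex \<Rightarrow> complex" and P :: "complex set"
    and A :: "complex mat" and m :: nat
    and \<gamma> :: "real \<Rightarrow> complex"
    and z :: "nat \<Rightarrow> complex" and d :: "nat \<Rightarrow> nat" and t :: nat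
  assumes "f meromorphic_on UNIV"
    and "P = {w. is_pole f w}"
    and "discrete P"
    and "f holomorphic_on (- P)"
    and "A \<in> carrier_mat m m"
    and "spectrum A \<inter> P = {}"
    and "simple_closed_curve \<gamma>"
    and "positively_oriented \<gamma>"
    and "path_image \<gamma> \<inter> P = {}"
    and "spectrum A \<subseteq> inside (path_image \<gamma>)"
    and "inj_on z {1..t}"
    and "z ` {1..t} = P \<inter> inside (path_image \<gamma>)"
    and "\<forall>j\<in>{1..t}. int (d j) = - zorder f (z j)"
  shows "(1 / (2 * of_real pi * \<i>)) \<cdot>\<^sub>m
           matrix_contour_integral m \<gamma> (\<lambda>w. f w \<cdot>\<^sub>m matrix_inverse (shifted w A))
         = matrix_function f A
           + matrix_sum m (\<lambda>j. R_matrix m f (z j) (d j) (shifted (z j) A)) {1..t}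
       \<and> ((\<forall>j\<in>{1..t}. d j = 1) \<longrightarrow>
         (1 / (2 * of_real pi * \<i>)) \<cdot>\<^sub>m
           matrix_contour_integral m \<gamma> (\<lambda>w. f w \<cdot>\<^sub>m matrix_inverse (shifted w A))
         = matrix_function f A
           + matrix_sum m (\<lambda>j. pole_cleared f (z j) (d j) (z j) \<cdot>\<^sub>m
               matrix_inverse (shifted (z j) A)) {1..t})"
    (is "?I = _ + ?S \<and> (?simple \<longrightarrow> _ = _ + ?S1)")
proof -
  have formula: "?I = V * fun_jordan_matrix f n_as * W + ?S"
    if "0 \<notin> fst ` set n_as" "similar_mat_wit A (jordan_matrix n_as) V W" for n_as V W
    using contour_integral_resolvent[OF assms(1,2,4-13) that] .
  obtain n_as V W where dec: "0 \<notin> fst ` set n_as" "similar_mat_wit A (jordan_matrix n_as) V W"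
    using jordan_decomposition_exists[OF assms(5)] .
  interpret D: jordan_decomposed A m n_as V W
    using assms(5) dec by unfold_locales
  have inverse: "matrix_inverse (shifted (z j) A) \<in> carrier_mat m m" if "j \<in> {1..t}" for j
  proof -
    have "z j \<in> P" using that assms(12) by blast
    then have "z j \<notin> snd ` set n_as"
      using D.eigenvalues_subset_spectrum assms(6) by blast
    then show ?thesis by (simp add: D.matrix_inverse_shifted D.resolvent_carrier)
  qed
  have S: "?S \<in> carrier_mat m m"
    by (intro matrix_sum_carrier R_matrix_carrier inverse) auto
  have "matrix_function f A = V * fun_jordan_matrix f n_as * W"
    unfolding matrix_function_def
  proof (rule the_equality)
    fix F assume "\<exists>n_as V W. 0 \<notin> fst ` set n_as \<and> similar_mat_wit A (jordan_matrix n_as) V W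
        \<and> F = V * fun_jordan_matrix f n_as * W"
    then obtain n_as' V' W' where dec': "0 \<notin> fst ` set n_as'"
        "similar_mat_wit A (jordan_matrix n_as') V' W'"
      and F: "F = V' * fun_jordan_matrix f n_as' * W'" by blast
    interpret D': jordan_decomposed A m n_as' V' W'
      using assms(5) dec' by unfold_locales
    show "F = V * fun_jordan_matrix f n_as * W"
    proof (rule add_right_cancel_mat[OF _ _ S])
      show "F \<in> carrier_mat m m"
        unfolding F using D'.V D'.W D'.fun_jordan_carrier by (intro mult_carrier_mat)
      show "V * fun_jordan_matrix f n_as * W \<in> carrier_mat m m"
        using D.V D.W D.fun_jordan_carrier by (intro mult_carrier_mat)
      show "F + ?S = V * fun_jordan_matrix f n_as * W + ?S"
        unfolding F using formula[OF dec] formula[OF dec'] by simp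
    qed
  qed (use dec in blast)
  with formula[OF dec] have general: "?I = matrix_function f A + ?S" by simp
  moreover have "?S = ?S1" if simple: ?simple
  proof (rule eq_matI)
    have S1: "?S1 \<in> carrier_mat m m"
      by (intro matrix_sum_carrier smult_carrier_mat inverse) auto
    show "dim_row ?S = dim_row ?S1" "dim_col ?S = dim_col ?S1" using S S1 by auto
    fix i k assume "i < dim_row ?S1" "k < dim_col ?S1"
    then have ik: "i < m" "k < m" using S1 by auto
    have "R_matrix m f (z j) (d j) (shifted (z j) A) =
        pole_cleared f (z j) (d j) (z j) \<cdot>\<^sub>m matrix_inverse (shifted (z j) A)"
      if j: "j \<in> {1..t}" for j
    proof -
      let ?N = "matrix_inverse (shifted (z j) A)"
      have "R_matrix m f (z j) (d j) (shifted (z j) A) =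
          matrix_sum m (\<lambda>l. R_coeff f (z j) 1 l \<cdot>\<^sub>m ?N ^\<^sub>m l) (insert 1 {})"
        using simple j by (simp add: R_matrix_def)
      also have "\<dots> = R_coeff f (z j) 1 1 \<cdot>\<^sub>m ?N"
        using inverse[OF j] by (subst matrix_sum_insert) auto
      also have "R_coeff f (z j) 1 1 = pole_cleared f (z j) (d j) (z j)"
        using simple j by (simp add: R_coeff_def)
      finally show ?thesis .
    qed
    then have "(\<Sum>j\<in>{1..t}. R_matrix m f (z j) (d j) (shifted (z j) A) $$ (i, k)) =
        (\<Sum>j\<in>{1..t}. (pole_cleared f (z j) (d j) (z j) \<cdot>\<^sub>m
          matrix_inverse (shifted (z j) A)) $$ (i, k))"
      by (intro sum.cong) simp_all
    also have "\<dots> = ?S1 $$ (i, k)"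
      by (rule matrix_sum_index[symmetric, OF finite_atLeastAtMost smult_carrier_mat[OF inverse] ik])
    also have "(\<Sum>j\<in>{1..t}. R_matrix m f (z j) (d j) (shifted (z j) A) $$ (i, k)) = ?S $$ (i, k)"
      by (rule matrix_sum_index[symmetric, OF finite_atLeastAtMost R_matrix_carrier[OF inverse] ik])
    finally show "?S $$ (i, k) = ?S1 $$ (i, k)" .
  qed
  ultimately show ?thesis by simp
qed

end
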